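(* Let $\mathcal{G}_n$ and $\mathcal{G}_r$ be graphs of order $n$ and $r$ respectively, with $n>r\ge 1$, and let $M$ assign to each graph $\mathcal{G}$ a real symmetric matrix $M(\mathcal{G})$ of size equal to the order of $\mathcal{G}$. Suppose there exist $r$-dimensional linear subspaces $\mathcal{A},\mathcal{B}\subseteq\mathbb{R}^n$, with associated injective linear maps $p_{\mathcal{A}}:\mathbb{R}^r\to\mathbb{R}^n$ with image $\mathcal{A}$ and $p_{\mathcal{B}}:\mathbb{R}^r\to\mathbb{R}^n$ with image $\mathcal{B}$, such that for all $x\in\mathbb{R}^r\setminus\{0\}$, $$R\left(M(\mathcal{G}_n),p_{\mathcal{A}}(x)\right)\le R\left(M(\mathcal{G}_r),x\right)\quad\text{and}\quad R\left(M(\mathcal{G}_n),p_{\mathcal{B}}(x)\right)\ge R\left(M(\mathcal{G}_r),x\right).$$ Then $\mathcal{G}_r$ and $\mathcal{G}_n$ are $M$-interlacing, i.e. $\lambda_k(M(\mathcal{G}_n))\le\lambda_k(M(\mathcal{G}_r))\le\lambda_{n-r+k}(M(\mathcal{G}_n))$ for $k=1,\dots,r$.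
   Context: For a real symmetric matrix $A\in\mathbb{R}^{n\times n}$, $\lambda_k(A)$ denotes its $k$th eigenvalue in ascending order (with multiplicity). The Rayleigh quotient is $R(A,x)=\frac{x^TAx}{x^Tx}$ for $x\neq 0$. The order of a graph is its number of vertices. *)

theory Defs
  imports
    "Graph_Theory.Pair_Digraph"
    "Jordan_Normal_Form.Char_Poly"
    "Jordan_Normal_Form.VS_Connect"
begin

definition graph_order :: "'a pair_pre_digraph \<Rightarrow> nat" where
  "graph_order G = card (pverts G)"

text \<open>
  Finite simple graphs are symmetric loop-free sets of vertex pairs (\<^locale>\<open>pair_graph\<close>).
  How the rows and columns of \<open>M G\<close> correspond to the vertices is part of the assignment \<open>M\<close>.
\<close>

definition symmetric_matrix_assignment :: "('a pair_pre_digraph \<Rightarrow> real mat) \<Rightarrow> bool" where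
  "symmetric_matrix_assignment M \<longleftrightarrow>
     (\<forall>G. pair_graph G \<longrightarrow>
        M G \<in> carrier_mat (graph_order G) (graph_order G) \<and> transpose_mat (M G) = M G)"

text \<open>
  The index \<open>k\<close> starts at 1. Eigenvalues are listed with their multiplicity as roots of the
  characteristic polynomial. A symmetric matrix has only real eigenvalues, so for a symmetric
  \<open>n \<times> n\<close> matrix the list has length \<open>n\<close>.
\<close>

definition kth_eigenvalue :: "nat \<Rightarrow> real mat \<Rightarrow> real" where
  "kth_eigenvalue k A = sorted_list_of_multiset (proots (char_poly A)) ! (k - 1)"

definition rayleigh_quotient :: "real mat \<Rightarrow> real vec \<Rightarrow> real" where
  "rayleigh_quotient A x = (x \<bullet> (A *\<^sub>v x)) / (x \<bullet> x)"

abbreviation real_space :: "nat \<Rightarrow> (real, real vec) module" where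
  "real_space n \<equiv> module_vec TYPE(real) n"

definition subspace_of_dim :: "nat \<Rightarrow> nat \<Rightarrow> real vec set \<Rightarrow> bool" where
  "subspace_of_dim n d W \<longleftrightarrow>
     VectorSpace.subspace class_ring W (real_space n) \<and>
     vectorspace.dim class_ring (real_space n\<lparr>carrier := W\<rparr>) = d"

definition injective_linear_map_onto ::
  "nat \<Rightarrow> nat \<Rightarrow> (real vec \<Rightarrow> real vec) \<Rightarrow> real vec set \<Rightarrow> bool" where
  "injective_linear_map_onto r n p W \<longleftrightarrow>
     linear_map class_ring (real_space r) (real_space n) p \<and>
     inj_on p (carrier_vec r) \<and> p ` carrier_vec r = W"

definition M_interlacing ::
  "('a pair_pre_digraph \<Rightarrow> real mat) \<Rightarrow> 'a pair_pre_digraph \<Rightarrow> 'a pair_pre_digraph \<Rightarrow> bool" where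
  "M_interlacing M Gr Gn \<longleftrightarrow>
     (\<forall>k \<in> {1..graph_order Gr}.
        kth_eigenvalue k (M Gn) \<le> kth_eigenvalue k (M Gr) \<and>
        kth_eigenvalue k (M Gr) \<le> kth_eigenvalue (graph_order Gn - graph_order Gr + k) (M Gn))"

end

theory Submission
  imports Defs
begin

text \<open>
  The argument is the Courant--Fischer argument, with the dimension count made in the small space
  \<open>\<real>\<^sup>r\<close>. Let \<open>u\<^sub>1, \<dots>, u\<^sub>r\<close> and \<open>w\<^sub>1, \<dots>, w\<^sub>n\<close> be orthonormal eigenvectors of \<open>M Gr\<close> and \<open>M Gn\<close>,
  ordered by increasing eigenvalue. Requiring of \<open>x \<in> \<real>\<^sup>r\<close> that it be orthogonal to
  \<open>u\<^sub>j\<close> for all \<open>j > k\<close> and that \<open>pA x\<close> be orthogonal to \<open>w\<^sub>i\<close> for all \<open>i < k\<close> imposes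
  \<open>(r - k) + (k - 1) < r\<close> linear conditions, so some nonzero \<open>x\<close> meets all of them. Only eigenvalues
  up to the \<open>k\<close>-th contribute to the Rayleigh quotient of \<open>M Gr\<close> at this \<open>x\<close>, and only those from the
  \<open>k\<close>-th on contribute to that of \<open>M Gn\<close> at \<open>pA x\<close>, which is nonzero because \<open>pA\<close> is injective. Hence
  \<open>\<lambda>\<^sub>k (M Gn) \<le> R (M Gn) (pA x) \<le> R (M Gr) x \<le> \<lambda>\<^sub>k (M Gr)\<close>. For the upper bound the
  conditions are mirrored: \<open>x\<close> is orthogonal to \<open>u\<^sub>j\<close> for \<open>j < k\<close>, and \<open>pB x\<close> to \<open>w\<^sub>i\<close> for
  \<open>i > n - r + k\<close>, which again makes \<open>(k - 1) + (r - k)\<close> conditions.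

  Two ingredients carry this. The first is the spectral theorem for real symmetric matrices, in the
  form that the quadratic form and the squared norm are diagonal in the same coordinates
  (\<open>symmetric_eigen_expansion_exists\<close>). It rests on \<open>orthogonal_diagonalization\<close>, which splits
  off one eigenvector at a time by a Householder reflection, and on \<open>char_poly_symmetric_splits\<close>,
  which ties the eigenvalues met there to the sorted list of roots that defines
  \<open>kth_eigenvalue\<close>. The second is that fewer than \<open>r\<close> linear functionals on \<open>\<real>\<^sup>r\<close> have a common
  nonzero zero (\<open>common_zero_of_few_functionals\<close>).
\<close>

section \<open>Orthogonal diagonalization of real symmetric matrices\<close>

lemma scalar_prod_self_pos:
  fixes x :: "real vec"
  assumes "x \<in> carrier_vec n" "x \<noteq> 0\<^sub>v n"
  shows "x \<bullet> x > 0"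
proof -
  have "x \<bullet>c x > 0"
    using conjugate_square_greater_0_vec[OF assms(1)] assms(2) by blast
  moreover have "conjugate x = x"
    by (intro eq_vecI) auto
  ultimately show ?thesis by simp
qed

text \<open>
  The Householder reflection in the hyperplane orthogonal to \<open>u - e\<close> exchanges the two unit vectors
  \<open>e = unit_vec n 0\<close> and \<open>u\<close>; if they coincide, the identity serves instead. Being symmetric and its own inverse, it turns similarity into congruence: conjugating
  by it preserves both the characteristic polynomial and symmetry.
\<close>

lemma exists_orthogonal_reflection_to_unit_vector:
  fixes u :: "real vec"
  assumes u: "u \<in> carrier_vec n" and unit: "u \<bullet> u = 1" and n: "0 < n"
  shows "\<exists>W \<in> carrier_mat n n. transpose_mat W = W \<and> W * W = 1\<^sub>m n \<and> W *\<^sub>v unit_vec n 0 = u"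
proof (cases "u = unit_vec n 0")
  case True
  then show ?thesis by (intro bexI[of _ "1\<^sub>m n"]) auto
next
  case False
  define e where "e = (unit_vec n 0 :: real vec)"
  have e: "e \<in> carrier_vec n" by (simp add: e_def)
  define v where "v = u - e"
  have v: "v \<in> carrier_vec n" using u e by (simp add: v_def)
  have v0: "v \<noteq> 0\<^sub>v n"
  proof
    assume "v = 0\<^sub>v n"
    then have "u $ i = e $ i" if "i < n" for i
      using that u e unfolding v_def by (metis (no_types) carrier_vecD eq_iff_diff_eq_0 index_minus_vec(1) index_zero_vec(1))
    then have "u = e" using u e by (intro eq_vecI) auto
    with False show False by (simp add: e_def)
  qed
  define s where "s = v \<bullet> v"
  have s: "s > 0" unfolding s_def by (rule scalar_prod_self_pos[OF v v0])
  have ue: "u \<bullet> e = u $ 0" and eu: "e \<bullet> u = u $ 0" and ee: "e \<bullet> e = 1"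
    using u n by (auto simp: e_def)
  \<comment> \<open>Since \<open>u\<close> and \<open>e\<close> are unit vectors, \<open>v \<bullet> e = - s / 2\<close>, so the reflection sends \<open>e\<close> to \<open>e + v = u\<close>.\<close>
  have s2: "s = 2 - 2 * u $ 0"
    unfolding s_def v_def using u e ue eu ee unit
    by (simp add: minus_scalar_prod_distrib[of _ n] scalar_prod_minus_distrib[of _ n])
  have sum_v: "(\<Sum>k<n. v $ k * v $ k) = s"
    using v by (simp add: s_def scalar_prod_def atLeast0LessThan)
  define W where "W = mat n n (\<lambda>(i,j). (if i = j then 1 else 0) - 2 / s * v $ i * v $ j)"
  have W: "W \<in> carrier_mat n n" by (simp add: W_def)
  have "transpose_mat W = W"
    by (intro eq_matI) (auto simp: W_def)
  moreover have "W * W = 1\<^sub>m n"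
  proof (intro eq_matI)
    fix i j assume "i < dim_row (1\<^sub>m n :: real mat)" "j < dim_col (1\<^sub>m n :: real mat)"
    then have i: "i < n" and j: "j < n" by auto
    define \<delta> where "\<delta> a b = (if a = b then 1 else 0 :: real)" for a b :: nat
    have delta_l: "(\<Sum>k<n. \<delta> i k * f k) = f i" if "i < n" for i f
    proof -
      have "(\<Sum>k<n. \<delta> i k * f k) = (\<Sum>k<n. if k = i then f k else 0)"
        by (intro sum.cong) (auto simp: \<delta>_def)
      then show ?thesis using that by simp
    qed
    have delta_r: "(\<Sum>k<n. f k * \<delta> k j) = f j" if "j < n" for j f
    proof -
      have "(\<Sum>k<n. f k * \<delta> k j) = (\<Sum>k<n. \<delta> j k * f k)"
        by (intro sum.cong) (auto simp: \<delta>_def)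
      then show ?thesis using delta_l[OF that] by simp
    qed
    have "(W * W) $$ (i,j) = (\<Sum>k<n. (\<delta> i k - 2/s * v $ i * v $ k) * (\<delta> k j - 2/s * v $ k * v $ j))"
      using i j by (simp add: W_def scalar_prod_def atLeast0LessThan \<delta>_def)
    also have "\<dots> = (\<Sum>k<n. \<delta> i k * \<delta> k j) - 2/s * v $ i * (\<Sum>k<n. v $ k * \<delta> k j)
        - 2/s * v $ j * (\<Sum>k<n. \<delta> i k * v $ k) + (2/s) * (2/s) * v $ i * v $ j * (\<Sum>k<n. v $ k * v $ k)"
      by (simp add: sum_distrib_left sum_divide_distrib algebra_simps sum.distrib sum_subtractf)
    also have "\<dots> = \<delta> i j"
      unfolding sum_v delta_l[OF i] delta_r[OF j] using s by (simp add: field_simps)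
    finally show "(W * W) $$ (i,j) = 1\<^sub>m n $$ (i,j)"
      using i j by (simp add: \<delta>_def)
  qed (auto simp: W_def)
  moreover have "W *\<^sub>v e = u"
  proof (intro eq_vecI)
    fix i assume "i < dim_vec u"
    then have i: "i < n" using u by simp
    have "(W *\<^sub>v e) $ i = W $$ (i, 0)"
      using i n W by (simp add: e_def scalar_prod_right_unit[of _ n])
    also have "\<dots> = e $ i - 2 / s * v $ i * v $ 0"
      using i n by (auto simp: W_def e_def)
    also have "v $ 0 = - s / 2"
      using n u s2 by (simp add: v_def e_def)
    also have "e $ i - 2 / s * v $ i * (- s / 2) = e $ i + v $ i"
      using s by simp
    also have "\<dots> = u $ i"
      using i u e by (simp add: v_def)
    finally show "(W *\<^sub>v e) $ i = u $ i" .
  qed (use u W in auto)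
  ultimately show ?thesis using W by (auto simp: e_def)
qed

text \<open>
  In coordinates where the eigenvector is the first basis vector, the eigenvector equation determines
  the first column of the matrix, and symmetry then clears the first row.
\<close>

lemma symmetric_deflation:
  fixes A :: "real mat"
  assumes A: "A \<in> carrier_mat (Suc m) (Suc m)" and sym: "transpose_mat A = A"
    and ev: "eigenvalue A e"
  obtains W A' where
    "W \<in> carrier_mat (Suc m) (Suc m)" "transpose_mat W = W" "W * W = 1\<^sub>m (Suc m)"
    "A' \<in> carrier_mat m m" "transpose_mat A' = A'"
    "A = W * four_block_mat (mat 1 1 (\<lambda>_. e)) (0\<^sub>m 1 m) (0\<^sub>m m 1) A' * W"
    "char_poly A = [:- e, 1:] * char_poly A'"
proof -
  let ?n = "Suc m"
  from ev obtain v where v: "v \<in> carrier_vec ?n" and v0: "v \<noteq> 0\<^sub>v ?n" and Av: "A *\<^sub>v v = e \<cdot>\<^sub>v v"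
    using A by (auto simp: eigenvalue_def eigenvector_def)
  define u where "u = (1 / sqrt (v \<bullet> v)) \<cdot>\<^sub>v v"
  have u: "u \<in> carrier_vec ?n" using v by (simp add: u_def)
  have pos: "v \<bullet> v > 0" by (rule scalar_prod_self_pos[OF v v0])
  have "u \<bullet> u = 1"
    using pos v by (simp add: u_def)
  then obtain W where W: "W \<in> carrier_mat ?n ?n" and Wt: "transpose_mat W = W"
    and WW: "W * W = 1\<^sub>m ?n" and We: "W *\<^sub>v unit_vec ?n 0 = u"
    using exists_orthogonal_reflection_to_unit_vector[OF u] by auto
  have Au: "A *\<^sub>v u = e \<cdot>\<^sub>v u"
    using A v Av by (simp add: u_def mult_mat_vec[OF A v] smult_smult_assoc mult.commute)
  define B where "B = W * A * W"
  have B: "B \<in> carrier_mat ?n ?n" using A W by (simp add: B_def)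
  have Bt: "transpose_mat B = B"
    unfolding B_def using A W Wt sym
    by (simp add: transpose_mult[of _ ?n ?n _ ?n] assoc_mult_mat[of _ ?n ?n _ ?n _ ?n])
  have AB: "A = W * B * W"
  proof -
    have "W * B * W = (W * W) * A * (W * W)"
      unfolding B_def using A W by (simp add: assoc_mult_mat[of _ ?n ?n _ ?n _ ?n])
    then show ?thesis using A W WW by simp
  qed
  have "B *\<^sub>v unit_vec ?n 0 = W *\<^sub>v (A *\<^sub>v (W *\<^sub>v unit_vec ?n 0))"
    unfolding B_def using A W by (simp add: assoc_mult_mat_vec[of _ ?n ?n _ ?n])
  also have "\<dots> = e \<cdot>\<^sub>v (W *\<^sub>v (W *\<^sub>v unit_vec ?n 0))"
    using We Au mult_mat_vec[OF W u] by simp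
  also have "W *\<^sub>v (W *\<^sub>v unit_vec ?n 0) = unit_vec ?n 0"
    using assoc_mult_mat_vec[OF W W, of "unit_vec ?n 0"] WW by simp
  finally have Be: "B *\<^sub>v unit_vec ?n 0 = e \<cdot>\<^sub>v unit_vec ?n 0" .
  have col0: "B $$ (i, 0) = (if i = 0 then e else 0)" if i: "i < ?n" for i
  proof -
    have "B $$ (i, 0) = (B *\<^sub>v unit_vec ?n 0) $ i"
      using i B by (simp add: scalar_prod_right_unit[of _ ?n])
    then show ?thesis using i by (simp add: Be)
  qed
  have row0: "B $$ (0, j) = (if j = 0 then e else 0)" if j: "j < ?n" for j
    using col0[OF j] Bt B j by (metis carrier_matD index_transpose_mat(1) zero_less_Suc)
  define A' where "A' = mat m m (\<lambda>(i,j). B $$ (Suc i, Suc j))"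
  have A': "A' \<in> carrier_mat m m" by (simp add: A'_def)
  have A't: "transpose_mat A' = A'"
  proof (intro eq_matI)
    fix i j assume "i < dim_row A'" "j < dim_col A'"
    then have ij: "i < m" "j < m" by (auto simp: A'_def)
    then have "B $$ (Suc j, Suc i) = B $$ (Suc i, Suc j)"
      using Bt B by (metis Suc_less_eq carrier_matD index_transpose_mat(1))
    then show "transpose_mat A' $$ (i, j) = A' $$ (i, j)"
      using ij by (simp add: A'_def)
  qed (auto simp: A'_def)
  let ?E = "mat 1 1 (\<lambda>_. e)"
  have Bblock: "B = four_block_mat ?E (0\<^sub>m 1 m) (0\<^sub>m m 1) A'"
    using B by (intro eq_matI) (auto simp: A'_def col0 row0)
  have "similar_mat A B"
    unfolding similar_mat_def similar_mat_wit_def Let_def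
    using A B W WW AB by (intro exI[of _ W]) auto
  then have "char_poly A = char_poly B" by (rule char_poly_similar)
  also have "\<dots> = char_poly ?E * char_poly A'"
    unfolding Bblock by (rule char_poly_four_block_zeros_col) (auto simp: A')
  also have "char_poly ?E = [:- e, 1:]"
    by (simp add: char_poly_defs det_single)
  finally have cp: "char_poly A = [:- e, 1:] * char_poly A'" .
  show ?thesis
    by (rule that[OF W Wt WW A' A't _ cp]) (use AB Bblock in simp)
qed

text \<open>
  The diagonal can be prescribed in any order of the roots, because each step may split off
  whichever root heads the list. This freedom makes the sorted list of eigenvalues usable below.
\<close>

theorem orthogonal_diagonalization:
  fixes A :: "real mat"
  assumes "A \<in> carrier_mat n n" "transpose_mat A = A"
    and "char_poly A = (\<Prod>e\<leftarrow>es. [:- e, 1:])"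
  shows "\<exists>U \<in> carrier_mat n n. transpose_mat U * U = 1\<^sub>m n \<and>
           A = transpose_mat U * mat_diag n (\<lambda>i. es ! i) * U"
  using assms
proof (induction es arbitrary: n A)
  case Nil
  then have "n = 0" using degree_monic_char_poly[OF Nil(1)] by simp
  then show ?case using Nil by (intro bexI[of _ "1\<^sub>m 0"]) auto
next
  case (Cons e es n A)
  have "degree (char_poly A) = Suc (length es)"
    unfolding Cons.prems(3) using degree_linear_factors[of uminus "e # es"] by simp
  then obtain m where n: "n = Suc m" and m: "n = 1 + m"
    using degree_monic_char_poly[OF Cons.prems(1)] by auto
  have "poly (char_poly A) e = 0" unfolding Cons.prems(3) by simp
  then have ev: "eigenvalue A e" using eigenvalue_root_char_poly[OF Cons.prems(1)] by simp
  obtain W A' where W: "W \<in> carrier_mat n n" and Wt: "transpose_mat W = W" and WW: "W * W = 1\<^sub>m n"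
    and A': "A' \<in> carrier_mat m m" and A't: "transpose_mat A' = A'"
    and AW: "A = W * four_block_mat (mat 1 1 (\<lambda>_. e)) (0\<^sub>m 1 m) (0\<^sub>m m 1) A' * W"
    and cp: "char_poly A = [:- e, 1:] * char_poly A'"
    using symmetric_deflation[OF _ Cons.prems(2) ev] Cons.prems(1) unfolding n by metis
  have "char_poly A' = (\<Prod>e\<leftarrow>es. [:- e, 1:])"
    using cp unfolding Cons.prems(3) by (simp del: mult_pCons_left)
  from Cons.IH[OF A' A't this] obtain U' where U': "U' \<in> carrier_mat m m"
    and UU': "transpose_mat U' * U' = 1\<^sub>m m"
    and AU': "A' = transpose_mat U' * mat_diag m (\<lambda>i. es ! i) * U'" by auto
  let ?E = "mat 1 1 (\<lambda>_. e)"
  \<comment> \<open>The diagonalizing matrix of the smaller block, extended by the identity in the split-off direction.\<close>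
  define V where "V = four_block_mat (1\<^sub>m 1) (0\<^sub>m 1 m) (0\<^sub>m m 1) U'"
  have V: "V \<in> carrier_mat n n" using U' unfolding V_def m by (intro four_block_carrier_mat) auto
  have Vt: "transpose_mat V = four_block_mat (1\<^sub>m 1) (0\<^sub>m 1 m) (0\<^sub>m m 1) (transpose_mat U')"
    unfolding V_def using U' by (subst transpose_four_block_mat) auto
  define D where "D = mat_diag n (\<lambda>i. (e # es) ! i)"
  have D: "D \<in> carrier_mat n n" by (simp add: D_def)
  have Dblock: "D = four_block_mat ?E (0\<^sub>m 1 m) (0\<^sub>m m 1) (mat_diag m (\<lambda>i. es ! i))"
    unfolding D_def m by (intro eq_matI) (auto simp: mat_diag_def)
  have VV: "transpose_mat V * V = 1\<^sub>m n"
    unfolding Vt unfolding V_def m using U' UU'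
    by (subst mult_four_block_mat[of _ 1 1 _ m _ m _ _ 1 _ m]) auto
  have VDV: "transpose_mat V * D * V = four_block_mat ?E (0\<^sub>m 1 m) (0\<^sub>m m 1) A'"
  proof -
    let ?L = "mat_diag m (\<lambda>i. es ! i)"
    have L: "?L \<in> carrier_mat m m" by simp
    have K: "transpose_mat U' * ?L \<in> carrier_mat m m"
      "transpose_mat U' * ?L * 0\<^sub>m m (Suc 0) = 0\<^sub>m m (Suc 0)"
      "0\<^sub>m m m + transpose_mat U' * ?L * U' = transpose_mat U' * ?L * U'"
      using U' L by (auto simp: left_add_zero_mat[of _ m m] right_mult_zero_mat[of _ m m])
    have "transpose_mat V * D = four_block_mat ?E (0\<^sub>m 1 m) (0\<^sub>m m 1) (transpose_mat U' * ?L)"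
      unfolding Vt Dblock using U' left_mult_zero_mat[OF L]
      by (subst mult_four_block_mat[of _ 1 1 _ m _ m _ _ 1 _ m]) auto
    then show ?thesis
      unfolding V_def using U' AU' K
      by (simp, subst mult_four_block_mat[of _ 1 1 _ m _ m _ _ 1 _ m]) auto
  qed
  define U where "U = V * W"
  have U: "U \<in> carrier_mat n n" using V W by (simp add: U_def)
  have Ut: "transpose_mat U = W * transpose_mat V"
    unfolding U_def using V W Wt by (simp add: transpose_mult[of _ n n _ n])
  have "transpose_mat U * U = W * (transpose_mat V * V) * W"
    unfolding Ut unfolding U_def using V W by (simp add: assoc_mult_mat[of _ n n _ n _ n])
  also have "\<dots> = 1\<^sub>m n" using VV W WW by simp
  finally have "transpose_mat U * U = 1\<^sub>m n" .
  moreover have "transpose_mat U * D * U = W * (transpose_mat V * D * V) * W"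
    unfolding Ut unfolding U_def using V W D by (simp add: assoc_mult_mat[of _ n n _ n _ n])
  then have "A = transpose_mat U * D * U" unfolding VDV AW ..
  ultimately show ?case using U unfolding D_def by blast
qed

section \<open>Real-rootedness of the characteristic polynomial\<close>

text \<open>
  For an eigenvector \<open>v\<close>, moving the matrix across the Hermitian product of \<open>v\<close> with itself multiplies
  it by \<open>z\<close> on one side and by the conjugate of \<open>z\<close> on the other.
\<close>

lemma complex_eigenvalue_of_symmetric_real:
  fixes A :: "real mat"
  assumes A: "A \<in> carrier_mat n n" and sym: "transpose_mat A = A"
    and root: "poly (char_poly (map_mat complex_of_real A)) z = 0"
  shows "z \<in> \<real>"
proof -
  define C where "C = map_mat complex_of_real A"
  have C: "C \<in> carrier_mat n n" using A by (simp add: C_def)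
  have Ct: "transpose_mat C = C"
    unfolding C_def by (subst sym[symmetric]) (intro eq_matI, auto)
  from root obtain v where v: "v \<in> carrier_vec n" and v0: "v \<noteq> 0\<^sub>v n" and Cv: "C *\<^sub>v v = z \<cdot>\<^sub>v v"
    using eigenvalue_root_char_poly[OF C, of z] C
    by (auto simp: C_def[symmetric] eigenvalue_def eigenvector_def)
  have cv: "conjugate v \<in> carrier_vec n" using v by simp
  have Ccv: "C *\<^sub>v conjugate v = conjugate (C *\<^sub>v v)"
  proof (intro eq_vecI)
    fix i assume "i < dim_vec (conjugate (C *\<^sub>v v))"
    then have i: "i < n" using C by simp
    show "(C *\<^sub>v conjugate v) $ i = conjugate (C *\<^sub>v v) $ i"
      using i A v by (simp add: C_def scalar_prod_def)
  qed (use C in auto)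
  have "z * (v \<bullet>c v) = (C *\<^sub>v v) \<bullet>c v"
    using v cv Cv by simp
  also have "\<dots> = v \<bullet> (C *\<^sub>v conjugate v)"
    using transpose_vec_mult_scalar[OF C cv v] Ct by simp
  also have "\<dots> = cnj z * (v \<bullet>c v)"
    unfolding Ccv Cv using v cv by (simp add: conjugate_smult_vec)
  finally have "z = cnj z"
    using v v0 by simp
  then show ?thesis by (simp add: Reals_cnj_iff)
qed

text \<open>
  Over the complex numbers the polynomial splits, and all roots are real, so the same factorization
  holds over the reals. In particular no eigenvalue is missing from \<open>proots\<close>, and the indices
  \<open>1, \<dots>, n\<close> of \<open>kth_eigenvalue\<close> are in range.
\<close>

lemma char_poly_symmetric_splits:
  fixes A :: "real mat"
  assumes A: "A \<in> carrier_mat n n" and sym: "transpose_mat A = A"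
  shows "char_poly A = (\<Prod>e\<leftarrow>sorted_list_of_multiset (proots (char_poly A)). [:- e, 1:])"
    and "size (proots (char_poly A)) = n"
proof -
  let ?C = "map_mat complex_of_real A"
  interpret poly_hom: map_poly_inj_comm_ring_hom complex_of_real ..
  have C: "?C \<in> carrier_mat n n" using A by simp
  obtain as where as: "char_poly ?C = (\<Prod>a\<leftarrow>as. [:- a, 1:])" and len: "length as = n"
    using char_poly_factorized[OF C] by blast
  have "a \<in> \<real>" if "a \<in> set as" for a
    using complex_eigenvalue_of_symmetric_real[OF A sym, of a] that
    by (simp add: as linear_poly_root)
  then have real: "map (\<lambda>a. complex_of_real (Re a)) as = as"
    by (intro map_idI) simp
  have "map_poly complex_of_real (char_poly A) = (\<Prod>a\<leftarrow>as. [:- a, 1:])"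
    by (subst of_real_hom.char_poly_hom[OF A, symmetric]) (rule as)
  also have "\<dots> = map_poly complex_of_real (\<Prod>e\<leftarrow>map Re as. [:- e, 1:])"
    by (subst real[symmetric]) (simp add: poly_hom.hom_prod_list o_def)
  finally have split: "char_poly A = (\<Prod>e\<leftarrow>map Re as. [:- e, 1:])"
    by simp
  have "proots (\<Prod>e\<leftarrow>es. [:- e, 1:]) = mset es" for es :: "real list"
    by (induction es) (simp_all add: proots_mult linear_poly_root prod_list_zero_iff image_iff del: mult_pCons_left)
  then have roots: "proots (char_poly A) = mset (map Re as)"
    by (metis split)
  show "size (proots (char_poly A)) = n" by (simp add: roots len)
  have "(\<Prod>e\<leftarrow>sorted_list_of_multiset (proots (char_poly A)). [:- e, 1:])
      = prod_mset (image_mset (\<lambda>e. [:- e, 1:]) (proots (char_poly A)))"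
    by (metis mset_map mset_sorted_list_of_multiset prod_mset_prod_list)
  also have "\<dots> = char_poly A"
    unfolding roots by (subst split) (metis mset_map prod_mset_prod_list)
  finally show "char_poly A = (\<Prod>e\<leftarrow>sorted_list_of_multiset (proots (char_poly A)). [:- e, 1:])" ..
qed

lemma kth_eigenvalue_mono:
  fixes A :: "real mat"
  assumes A: "A \<in> carrier_mat n n" and sym: "transpose_mat A = A"
    and "1 \<le> j" "j \<le> k" "k \<le> n"
  shows "kth_eigenvalue j A \<le> kth_eigenvalue k A"
proof -
  have "length (sorted_list_of_multiset (proots (char_poly A))) = n"
    using char_poly_symmetric_splits(2)[OF A sym]
    by (metis mset_sorted_list_of_multiset size_mset)
  then show ?thesis
    unfolding kth_eigenvalue_def using assms(3-5) by (intro sorted_nth_mono) auto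
qed

section \<open>Rayleigh quotients in eigenvector coordinates\<close>

text \<open>
  For symmetric \<open>A\<close>, the vectors \<open>w 1, \<dots>, w n\<close> are an orthonormal eigenbasis, with \<open>w i\<close> belonging to the \<open>i\<close>-th
  eigenvalue in ascending order. It is described by the two sums of squares that it produces, which
  are the numerator and the denominator of the Rayleigh quotient.
\<close>

definition eigen_expansion :: "nat \<Rightarrow> real mat \<Rightarrow> (nat \<Rightarrow> real vec) \<Rightarrow> bool" where
  "eigen_expansion n A w \<longleftrightarrow>
     (\<forall>i \<in> {1..n}. w i \<in> carrier_vec n) \<and>
     (\<forall>x \<in> carrier_vec n.
        x \<bullet> x = (\<Sum>i=1..n. (w i \<bullet> x)\<^sup>2) \<and>
        x \<bullet> (A *\<^sub>v x) = (\<Sum>i=1..n. kth_eigenvalue i A * (w i \<bullet> x)\<^sup>2))"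

theorem symmetric_eigen_expansion_exists:
  fixes A :: "real mat"
  assumes A: "A \<in> carrier_mat n n" and sym: "transpose_mat A = A"
  obtains w where "eigen_expansion n A w"
proof -
  define es where "es = sorted_list_of_multiset (proots (char_poly A))"
  obtain U where U: "U \<in> carrier_mat n n" and UU: "transpose_mat U * U = 1\<^sub>m n"
    and AU: "A = transpose_mat U * mat_diag n (\<lambda>i. es ! i) * U"
    using orthogonal_diagonalization[OF A sym char_poly_symmetric_splits(1)[OF A sym]]
    unfolding es_def by blast
  let ?D = "mat_diag n (\<lambda>i. es ! i)"
  \<comment> \<open>Rows of \<open>U\<close> and list positions count from 0, eigenvalues from 1.\<close>
  define w where "w i = row U (i - 1)" for i
  have shift: "(\<Sum>i=1..n. f i) = (\<Sum>i<n. f (Suc i))" for f :: "nat \<Rightarrow> real"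
    unfolding One_nat_def by (rule sum.atLeast1_atMost_eq)
  have "eigen_expansion n A w"
    unfolding eigen_expansion_def
  proof (intro conjI ballI)
    show "w i \<in> carrier_vec n" if "i \<in> {1..n}" for i
      unfolding w_def by (intro row_carrier_vec[OF _ U]) (use that in auto)
  next
    fix x :: "real vec" assume x: "x \<in> carrier_vec n"
    have Ux: "U *\<^sub>v x \<in> carrier_vec n" using U x by simp
    have Ut: "transpose_mat U \<in> carrier_mat n n" using U by simp
    have "x = transpose_mat U *\<^sub>v (U *\<^sub>v x)"
      using assoc_mult_mat_vec[OF Ut U x] UU x by simp
    then have "x \<bullet> x = (transpose_mat U *\<^sub>v (U *\<^sub>v x)) \<bullet> x" by simp
    also have "\<dots> = (U *\<^sub>v x) \<bullet> (U *\<^sub>v x)"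
      using transpose_vec_mult_scalar[OF U x Ux] by simp
    also have "\<dots> = (\<Sum>i=1..n. (w i \<bullet> x)\<^sup>2)"
      unfolding shift using U by (simp add: scalar_prod_def[of "U *\<^sub>v x"] atLeast0LessThan w_def power2_eq_square)
    finally show "x \<bullet> x = (\<Sum>i=1..n. (w i \<bullet> x)\<^sup>2)" .
    have D: "?D \<in> carrier_mat n n" by simp
    have Dy: "?D *\<^sub>v y = vec n (\<lambda>i. es ! i * y $ i)" if "y \<in> carrier_vec n" for y
      using that
      by (intro eq_vecI) (auto simp: mat_diag_def scalar_prod_def if_distrib[of "\<lambda>t. t * _"] cong: if_cong)
    have "A *\<^sub>v x = transpose_mat U *\<^sub>v (?D *\<^sub>v (U *\<^sub>v x))"
      unfolding AU using U Ut D x by (simp add: assoc_mult_mat_vec[of _ n n _ n])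
    then have "x \<bullet> (A *\<^sub>v x) = (transpose_mat U *\<^sub>v (?D *\<^sub>v (U *\<^sub>v x))) \<bullet> x"
      using comm_scalar_prod[OF x mult_mat_vec_carrier[OF A x]] by simp
    also have "\<dots> = (?D *\<^sub>v (U *\<^sub>v x)) \<bullet> (U *\<^sub>v x)"
      using transpose_vec_mult_scalar[OF U x, of "?D *\<^sub>v (U *\<^sub>v x)"] D Ux by simp
    also have "\<dots> = (\<Sum>i=1..n. kth_eigenvalue i A * (w i \<bullet> x)\<^sup>2)"
      unfolding shift Dy[OF Ux] using U
      by (simp add: scalar_prod_def[of _ "U *\<^sub>v x"] atLeast0LessThan w_def power2_eq_square
            kth_eigenvalue_def es_def mult.assoc)
    finally show "x \<bullet> (A *\<^sub>v x) = (\<Sum>i=1..n. kth_eigenvalue i A * (w i \<bullet> x)\<^sup>2)" .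
  qed
  then show ?thesis by (rule that)
qed

text \<open>
  The Rayleigh quotient is an average of the eigenvalues with weights \<open>(w i \<bullet> x)\<^sup>2\<close>, so only
  eigenvalues of nonzero weight can affect a bound.
\<close>

lemma
  assumes w: "eigen_expansion n A w" and x: "x \<in> carrier_vec n" "x \<noteq> 0\<^sub>v n"
  shows rayleigh_quotient_ge:
      "(\<And>i. i \<in> {1..n} \<Longrightarrow> w i \<bullet> x \<noteq> 0 \<Longrightarrow> c \<le> kth_eigenvalue i A) \<Longrightarrow> c \<le> rayleigh_quotient A x"
    and rayleigh_quotient_le:
      "(\<And>i. i \<in> {1..n} \<Longrightarrow> w i \<bullet> x \<noteq> 0 \<Longrightarrow> kth_eigenvalue i A \<le> c) \<Longrightarrow> rayleigh_quotient A x \<le> c"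
proof -
  have norm: "c * (x \<bullet> x) = (\<Sum>i=1..n. c * (w i \<bullet> x)\<^sup>2)"
    and form: "x \<bullet> (A *\<^sub>v x) = (\<Sum>i=1..n. kth_eigenvalue i A * (w i \<bullet> x)\<^sup>2)"
    using w x(1) unfolding eigen_expansion_def by (simp_all add: sum_distrib_left)
  note pos = scalar_prod_self_pos[OF x]
  {
    assume c: "\<And>i. i \<in> {1..n} \<Longrightarrow> w i \<bullet> x \<noteq> 0 \<Longrightarrow> c \<le> kth_eigenvalue i A"
    have "c * (w i \<bullet> x)\<^sup>2 \<le> kth_eigenvalue i A * (w i \<bullet> x)\<^sup>2" if "i \<in> {1..n}" for i
      using c[OF that] by (cases "w i \<bullet> x = 0") (auto intro: mult_right_mono)
    then have "c * (x \<bullet> x) \<le> x \<bullet> (A *\<^sub>v x)"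
      unfolding norm form by (rule sum_mono)
    then show "c \<le> rayleigh_quotient A x"
      unfolding rayleigh_quotient_def using pos by (simp add: pos_le_divide_eq)
  next
    assume c: "\<And>i. i \<in> {1..n} \<Longrightarrow> w i \<bullet> x \<noteq> 0 \<Longrightarrow> kth_eigenvalue i A \<le> c"
    have "kth_eigenvalue i A * (w i \<bullet> x)\<^sup>2 \<le> c * (w i \<bullet> x)\<^sup>2" if "i \<in> {1..n}" for i
      using c[OF that] by (cases "w i \<bullet> x = 0") (auto intro: mult_right_mono)
    then have "x \<bullet> (A *\<^sub>v x) \<le> c * (x \<bullet> x)"
      unfolding norm form by (rule sum_mono)
    then show "rayleigh_quotient A x \<le> c"
      unfolding rayleigh_quotient_def using pos by (simp add: pos_divide_le_eq)
  }
qed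

section \<open>Common zeros of few linear functionals\<close>

definition linear_functional :: "nat \<Rightarrow> (real vec \<Rightarrow> real) \<Rightarrow> bool" where
  "linear_functional r f \<longleftrightarrow>
     (\<forall>x \<in> carrier_vec r. \<forall>y \<in> carrier_vec r. f (x + y) = f x + f y) \<and>
     (\<forall>c. \<forall>x \<in> carrier_vec r. f (c \<cdot>\<^sub>v x) = c * f x)"

text \<open>
  The expansion of \<open>x\<close> in unit vectors is added up one coordinate at a time, by induction on the
  number \<open>k\<close> of coordinates kept.
\<close>

lemma linear_functional_as_scalar_prod:
  assumes f: "linear_functional r f" and x: "x \<in> carrier_vec r"
  shows "f x = vec r (\<lambda>i. f (unit_vec r i)) \<bullet> x"
proof -
  have "f (vec r (\<lambda>i. if i < k then x $ i else 0)) = (\<Sum>i<k. f (unit_vec r i) * x $ i)" if "k \<le> r" for k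
    using that
  proof (induction k)
    case 0
    have "vec r (\<lambda>i. if i < 0 then x $ i else 0) = 0 \<cdot>\<^sub>v x"
      using x by (intro eq_vecI) auto
    moreover have "f (0 \<cdot>\<^sub>v x) = 0 * f x" using f x unfolding linear_functional_def by blast
    ultimately show ?case by simp
  next
    case (Suc k)
    let ?y = "\<lambda>k. vec r (\<lambda>i. if i < k then x $ i else 0)"
    have "?y (Suc k) = ?y k + x $ k \<cdot>\<^sub>v unit_vec r k"
      using Suc.prems by (intro eq_vecI) (auto simp: less_Suc_eq)
    then have "f (?y (Suc k)) = f (?y k) + x $ k * f (unit_vec r k)"
      using f unfolding linear_functional_def by simp
    then show ?case using Suc by simp
  qed
  from this[of r] have "f (vec r (\<lambda>i. if i < r then x $ i else 0)) = (\<Sum>i<r. f (unit_vec r i) * x $ i)"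
    by simp
  also have "vec r (\<lambda>i. if i < r then x $ i else 0) = x"
    using x by (intro eq_vecI) auto
  finally show ?thesis using x by (simp add: scalar_prod_def atLeast0LessThan)
qed

text \<open>
  The functionals are the rows of a matrix, which is filled up with zero rows to size \<open>r \<times> r\<close>. There
  is at least one such row, so the determinant vanishes, and a vector in the kernel is a common zero.
\<close>

lemma common_zero_of_few_functionals:
  assumes lin: "\<And>f. f \<in> set fs \<Longrightarrow> linear_functional r f" and few: "length fs < r"
  obtains x where "x \<in> carrier_vec r" "x \<noteq> 0\<^sub>v r" "\<And>f. f \<in> set fs \<Longrightarrow> f x = 0"
proof -
  define G where "G = mat r r (\<lambda>(i,j). if i < length fs then (fs ! i) (unit_vec r j) else 0)"
  have G: "G \<in> carrier_mat r r" by (simp add: G_def)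
  have "row G (length fs) = 0\<^sub>v r"
    using few by (intro eq_vecI) (auto simp: G_def)
  then have "transpose_mat G *\<^sub>v unit_vec r (length fs) = 0\<^sub>v r"
    using few G by (intro eq_vecI) (auto simp: scalar_prod_right_unit[of _ r] row_def vec_eq_iff)
  then have "det (transpose_mat G) = 0"
    using det_0_iff_vec_prod_zero_field[of "transpose_mat G" r] few G
    by (metis transpose_carrier_mat unit_vec_carrier unit_vec_nonzero)
  then have "det G = 0"
    using det_transpose[OF G] by simp
  then obtain x where x: "x \<in> carrier_vec r" and x0: "x \<noteq> 0\<^sub>v r" and Gx: "G *\<^sub>v x = 0\<^sub>v r"
    using det_0_iff_vec_prod_zero_field[OF G] by blast
  have "f x = 0" if "f \<in> set fs" for f
  proof -
    from that obtain i where i: "i < length fs" and f: "f = fs ! i"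
      by (auto simp: in_set_conv_nth)
    have "row G i = vec r (\<lambda>j. f (unit_vec r j))"
      using i few by (intro eq_vecI) (auto simp: G_def f)
    then have "f x = (G *\<^sub>v x) $ i"
      using linear_functional_as_scalar_prod[OF lin[OF that] x] i few G by simp
    then show ?thesis using Gx i few by simp
  qed
  with x x0 show ?thesis using that by blast
qed


text \<open>
  Orthogonality of \<open>p x\<close> to a vector of the large space is a single linear condition on \<open>x\<close>, whatever
  the dimension of that space; hence only the number of conditions counts, against \<open>r\<close>.
\<close>

lemma exists_orthogonal_test_vector:
  fixes us vs :: "real vec list"
  assumes p: "linear_map class_ring (real_space r) (real_space n) p"
    and us: "set us \<subseteq> carrier_vec r" and vs: "set vs \<subseteq> carrier_vec n"
    and few: "length us + length vs < r"
  obtains x where "x \<in> carrier_vec r" "x \<noteq> 0\<^sub>v r"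
    "\<And>u. u \<in> set us \<Longrightarrow> u \<bullet> x = 0" "\<And>v. v \<in> set vs \<Longrightarrow> v \<bullet> p x = 0"
proof -
  have p_closed: "p x \<in> carrier_vec n" if "x \<in> carrier_vec r" for x
    using linear_map.T_im[OF p, of x] that by (simp add: module_vec_simps)
  have p_add: "p (x + y) = p x + p y" if "x \<in> carrier_vec r" "y \<in> carrier_vec r" for x y
    using linear_map.T_add[OF p, of x y] that by (simp add: module_vec_simps)
  have p_smult: "p (c \<cdot>\<^sub>v x) = c \<cdot>\<^sub>v p x" if "x \<in> carrier_vec r" for c x
    using linear_map.T_smult[OF p, of c x] that by (simp add: module_vec_simps class_ring_simps)
  let ?fs = "map (\<lambda>u x. u \<bullet> x) us @ map (\<lambda>v x. v \<bullet> p x) vs"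
  have lin: "linear_functional r f" if "f \<in> set ?fs" for f
    using that us vs unfolding linear_functional_def
    by (auto simp: p_add p_smult scalar_prod_add_distrib[of _ r] scalar_prod_add_distrib[of _ n] p_closed subset_iff)
  have "length ?fs < r" using few by simp
  then obtain x where "x \<in> carrier_vec r" "x \<noteq> 0\<^sub>v r" "\<And>f. f \<in> set ?fs \<Longrightarrow> f x = 0"
    using common_zero_of_few_functionals[OF lin] by blast
  then show ?thesis by (intro that[of x]) auto
qed

section \<open>Eigenvalue comparison and interlacing\<close>

lemma injective_linear_map_nonzero:
  assumes p: "linear_map class_ring (real_space r) (real_space n) p"
    and inj: "inj_on p (carrier_vec r)"
    and x: "x \<in> carrier_vec r" "x \<noteq> 0\<^sub>v r"
  shows "p x \<in> carrier_vec n" "p x \<noteq> 0\<^sub>v n"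
proof -
  show "p x \<in> carrier_vec n"
    using linear_map.T_im[OF p, of x] x by (simp add: module_vec_simps)
  have "p (0\<^sub>v r) = 0\<^sub>v n"
    using linear_map.T0_is_0[OF p] by (simp add: module_vec_simps)
  then show "p x \<noteq> 0\<^sub>v n"
    using inj x by (metis inj_on_def zero_carrier_vec)
qed

text \<open>
  The \<open>r - k\<close> conditions on \<open>x\<close> and the \<open>k - 1\<close> conditions on \<open>p x\<close> are the most that a nonzero \<open>x\<close>
  can be guaranteed to meet, and they confine both Rayleigh quotients to the side of the \<open>k\<close>-th
  eigenvalue that is needed.
\<close>

theorem eigenvalue_le_of_rayleigh_le:
  fixes A B :: "real mat"
  assumes A: "A \<in> carrier_mat n n" "transpose_mat A = A"
    and B: "B \<in> carrier_mat r r" "transpose_mat B = B"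
    and p: "linear_map class_ring (real_space r) (real_space n) p" "inj_on p (carrier_vec r)"
    and le: "\<And>x. x \<in> carrier_vec r \<Longrightarrow> x \<noteq> 0\<^sub>v r \<Longrightarrow>
               rayleigh_quotient A (p x) \<le> rayleigh_quotient B x"
    and k: "k \<in> {1..r}" and rn: "r \<le> n"
  shows "kth_eigenvalue k A \<le> kth_eigenvalue k B"
proof -
  obtain w where w: "eigen_expansion n A w" using symmetric_eigen_expansion_exists[OF A] .
  obtain u where u: "eigen_expansion r B u" using symmetric_eigen_expansion_exists[OF B] .
  have us: "set (map u [Suc k..<Suc r]) \<subseteq> carrier_vec r"
    and ws: "set (map w [1..<k]) \<subseteq> carrier_vec n"
    using u w k rn unfolding eigen_expansion_def by auto
  have few: "length (map u [Suc k..<Suc r]) + length (map w [1..<k]) < r"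
    using k by auto
  obtain x where x: "x \<in> carrier_vec r" "x \<noteq> 0\<^sub>v r"
    and u0: "\<And>v. v \<in> set (map u [Suc k..<Suc r]) \<Longrightarrow> v \<bullet> x = 0"
    and w0: "\<And>v. v \<in> set (map w [1..<k]) \<Longrightarrow> v \<bullet> p x = 0"
    using exists_orthogonal_test_vector[OF p(1) us ws few] by blast
  have ux: "u j \<bullet> x = 0" if "j \<in> {k<..r}" for j
    using that by (intro u0, unfold set_map, intro imageI) auto
  have wx: "w i \<bullet> p x = 0" if "i \<in> {1..<k}" for i
    using that by (intro w0, unfold set_map, intro imageI) auto
  note px = injective_linear_map_nonzero[OF p x]
  have "kth_eigenvalue k A \<le> rayleigh_quotient A (p x)"
  proof (rule rayleigh_quotient_ge[OF w px])
    fix i assume "i \<in> {1..n}" "w i \<bullet> p x \<noteq> 0"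
    then show "kth_eigenvalue k A \<le> kth_eigenvalue i A"
      using wx[of i] k by (intro kth_eigenvalue_mono[OF A]) force+
  qed
  also have "\<dots> \<le> rayleigh_quotient B x" by (rule le[OF x])
  also have "\<dots> \<le> kth_eigenvalue k B"
  proof (rule rayleigh_quotient_le[OF u x])
    fix j assume "j \<in> {1..r}" "u j \<bullet> x \<noteq> 0"
    then show "kth_eigenvalue j B \<le> kth_eigenvalue k B"
      using ux[of j] k by (intro kth_eigenvalue_mono[OF B]) force+
  qed
  finally show ?thesis .
qed

text \<open>
  The roles of small and large eigenvalues are exchanged. The shift \<open>n - r\<close> comes from the count:
  after \<open>k - 1\<close> conditions on \<open>x\<close> there is room for \<open>r - k\<close> conditions on \<open>p x\<close>, which can remove
  just the eigenvalues of \<open>A\<close> above the \<open>(n - r + k)\<close>-th.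
\<close>

theorem eigenvalue_ge_of_rayleigh_ge:
  fixes A B :: "real mat"
  assumes A: "A \<in> carrier_mat n n" "transpose_mat A = A"
    and B: "B \<in> carrier_mat r r" "transpose_mat B = B"
    and p: "linear_map class_ring (real_space r) (real_space n) p" "inj_on p (carrier_vec r)"
    and ge: "\<And>x. x \<in> carrier_vec r \<Longrightarrow> x \<noteq> 0\<^sub>v r \<Longrightarrow>
               rayleigh_quotient A (p x) \<ge> rayleigh_quotient B x"
    and k: "k \<in> {1..r}" and rn: "r \<le> n"
  shows "kth_eigenvalue k B \<le> kth_eigenvalue (n - r + k) A"
proof -
  let ?l = "n - r + k"
  obtain w where w: "eigen_expansion n A w" using symmetric_eigen_expansion_exists[OF A] .
  obtain u where u: "eigen_expansion r B u" using symmetric_eigen_expansion_exists[OF B] .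
  have us: "set (map u [1..<k]) \<subseteq> carrier_vec r"
    and ws: "set (map w [Suc ?l..<Suc n]) \<subseteq> carrier_vec n"
    using u w k unfolding eigen_expansion_def by auto
  have few: "length (map u [1..<k]) + length (map w [Suc ?l..<Suc n]) < r"
    using k rn by auto
  obtain x where x: "x \<in> carrier_vec r" "x \<noteq> 0\<^sub>v r"
    and u0: "\<And>v. v \<in> set (map u [1..<k]) \<Longrightarrow> v \<bullet> x = 0"
    and w0: "\<And>v. v \<in> set (map w [Suc ?l..<Suc n]) \<Longrightarrow> v \<bullet> p x = 0"
    using exists_orthogonal_test_vector[OF p(1) us ws few] by blast
  have ux: "u j \<bullet> x = 0" if "j \<in> {1..<k}" for j
    using that by (intro u0, unfold set_map, intro imageI) auto
  have wx: "w i \<bullet> p x = 0" if "i \<in> {?l<..n}" for i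
    using that by (intro w0, unfold set_map, intro imageI) auto
  note px = injective_linear_map_nonzero[OF p x]
  have "kth_eigenvalue k B \<le> rayleigh_quotient B x"
  proof (rule rayleigh_quotient_ge[OF u x])
    fix j assume "j \<in> {1..r}" "u j \<bullet> x \<noteq> 0"
    then show "kth_eigenvalue k B \<le> kth_eigenvalue j B"
      using ux[of j] k by (intro kth_eigenvalue_mono[OF B]) force+
  qed
  also have "\<dots> \<le> rayleigh_quotient A (p x)" by (rule ge[OF x])
  also have "\<dots> \<le> kth_eigenvalue ?l A"
  proof (rule rayleigh_quotient_le[OF w px])
    fix i assume "i \<in> {1..n}" "w i \<bullet> p x \<noteq> 0"
    then show "kth_eigenvalue i A \<le> kth_eigenvalue ?l A"
      using wx[of i] k rn by (intro kth_eigenvalue_mono[OF A]) force+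
  qed
  finally show ?thesis .
qed

theorem theorem3:
  fixes M :: "'a pair_pre_digraph \<Rightarrow> real mat"
    and Gn Gr :: "'a pair_pre_digraph"
    and n r :: nat
    and A B :: "real vec set"
    and pA pB :: "real vec \<Rightarrow> real vec"
  assumes "pair_graph Gn" and "graph_order Gn = n"
    and "pair_graph Gr" and "graph_order Gr = r"
    and "n > r" and "r \<ge> 1"
    and "symmetric_matrix_assignment M"
    and "subspace_of_dim n r A" and "subspace_of_dim n r B"
    and "injective_linear_map_onto r n pA A"
    and "injective_linear_map_onto r n pB B"
    and "\<And>x. x \<in> carrier_vec r \<Longrightarrow> x \<noteq> 0\<^sub>v r \<Longrightarrow>
           rayleigh_quotient (M Gn) (pA x) \<le> rayleigh_quotient (M Gr) x"
    and "\<And>x. x \<in> carrier_vec r \<Longrightarrow> x \<noteq> 0\<^sub>v r \<Longrightarrow>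
           rayleigh_quotient (M Gn) (pB x) \<ge> rayleigh_quotient (M Gr) x"
  shows "M_interlacing M Gr Gn"
proof -
  have Mn: "M Gn \<in> carrier_mat n n" "transpose_mat (M Gn) = M Gn"
    and Mr: "M Gr \<in> carrier_mat r r" "transpose_mat (M Gr) = M Gr"
    using assms(1-4,7) unfolding symmetric_matrix_assignment_def by auto
  have pA: "linear_map class_ring (real_space r) (real_space n) pA" "inj_on pA (carrier_vec r)"
    and pB: "linear_map class_ring (real_space r) (real_space n) pB" "inj_on pB (carrier_vec r)"
    using assms(10,11) unfolding injective_linear_map_onto_def by auto
  have rn: "r \<le> n" using assms(5) by simp
  show ?thesis
    unfolding M_interlacing_def assms(2,4)
    using eigenvalue_le_of_rayleigh_le[OF Mn Mr pA assms(12) _ rn]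
      eigenvalue_ge_of_rayleigh_ge[OF Mn Mr pB assms(13) _ rn]
    by blast
qed

end
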